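(* Let $\Bbbk$ be a unital commutative ring and let $n\ge1$, $r\ge0$ be integers. Let $\varphi:\mathcal{B}\to[n]^r\times[n]^r$, $\varphi(\sigma)=(\underline{i}(\sigma),\underline{j}(\sigma))$, and $\psi:\mathcal{C}\to[n]^r\times[n]^r$, $\psi(w)=(\underline{i}(w),\underline{j}(w))$, be injective maps such that each $\sigma\in\mathcal{B}$ is the unique element of minimal Coxeter length among the $\sigma'\in\mathcal{B}$ with $\underline{i}(\sigma)\,\sigma'=\underline{j}(\sigma)$, and each $w\in\mathcal{C}$ is the unique element of minimal Coxeter length among the $w'\in\mathcal{C}$ with $w'\underline{j}(w)=\underline{i}(w)$. (i) There are integers $a_{\sigma,\sigma'}$ ($\sigma,\sigma'\in\mathcal{B}$) such that for every $X\in\operatorname{End}_{S(n,r)}(\mathbf{V}^{\otimes r})$, the unique scalars $c(\sigma)\in\Bbbk$ with $X=\sum_{\sigma\in\mathcal{B}}c(\sigma)\Phi(\sigma)$ satisfy $c(\sigma)=\sum_{\sigma'\in\mathcal{B}}a_{\sigma,\sigma'}X_{\underline{i}(\sigma'),\underline{j}(\sigma')}$ for all $\sigma\in\mathcal{B}$. (ii) There are integers $b_{w,w'}$ ($w,w'\in\mathcal{C}$) such that for every $X\in\operatorname{End}_{\mathcal{P}_r(n)}(\mathbf{V}^{\otimes r})$, the unique scalars $c(w)\in\Bbbk$ with $X=\sum_{w\in\mathcal{C}}c(w)\Psi(w)$ satisfy $c(w)=\sum_{w'\in\mathcal{C}}b_{w,w'}X_{\underline{i}(w'),\underline{j}(w')}$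 for all $w\in\mathcal{C}$.
   Context: $[n]=\{1,\dots,n\}$; $\mathfrak{S}_r$ and $W_n$ are the symmetric groups on $[r]$ and $[n]$. $\operatorname{LLIS}$ (resp. $\operatorname{LLDS}$) denotes the length of a longest increasing (resp. decreasing) subsequence of a permutation in one-line notation. $\mathcal{B}=\{\sigma\in\mathfrak{S}_r\mid\operatorname{LLDS}(\sigma)\le n\}$, $\mathcal{C}=\{w\in W_n\mid\operatorname{LLIS}(w)\ge n-r\}$. Coxeter length is the number of inversions. $\mathbf{V}$ is a free $\Bbbk$-module with basis $\mathbf{v}_1,\dots,\mathbf{v}_n$; for $\underline{j}=(j_1,\dots,j_r)\in[n]^r$ put $\mathbf{v}_{\underline{j}}=\mathbf{v}_{j_1}\otimes\cdots\otimes\mathbf{v}_{j_r}$; these form a basis of $\mathbf{V}^{\otimes r}$. Put $\underline{j}\,\sigma=(j_{\sigma(1)},\dots,j_{\sigma(r)})$ and $w\underline{j}=(w(j_1),\dots,w(j_r))$. $\mathfrak{S}_r$ acts on the right by $\mathbf{v}_{\underline{j}}\cdot\sigma=\mathbf{v}_{\underline{j}\sigma}$ and $W_n$ acts on the left by $w\cdot\mathbf{v}_{\underline{j}}=\mathbf{v}_{w\underline{j}}$; $\Phi:\Bbbk[\mathfrak{S}_r]^{\mathrm{op}}\to\operatorname{End}_\Bbbk(\mathbf{V}^{\otimes r})$ and $\Psi:\Bbbk[W_n]\to\operatorname{End}_\Bbbk(\mathbf{V}^{\otimes r})$ are the corresponding representations. The Schur algebra is $S(n,r)=\operatorname{End}_{\mathfrak{S}_r}(\mathbf{V}^{\otimes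 r})$ (the $\Bbbk$-endomorphisms commuting with the place-permutation action). The partition algebra $\mathcal{P}_r(n)$ has $\Bbbk$-basis the set partitions $d$ of $\{1,\dots,r,1',\dots,r'\}$; $d$ acts on $\mathbf{V}^{\otimes r}$ by the operator whose $(\underline{i},\underline{j})$ matrix entry is $1$ if, upon labelling vertex $a$ by $i_a$ and vertex $a'$ by $j_a$, labels are constant on every block of $d$, and $0$ otherwise. $\operatorname{End}_{\mathcal{P}_r(n)}(\mathbf{V}^{\otimes r})$ is the set of $\Bbbk$-endomorphisms commuting with all these operators. It is known (Raghavan–Samuel–Subrahmanyam; Doty) that $\{\Phi(\sigma)\}_{\sigma\in\mathcal{B}}$ is a $\Bbbk$-basis of $\operatorname{End}_{S(n,r)}(\mathbf{V}^{\otimes r})$ and $\{\Psi(w)\}_{w\in\mathcal{C}}$ is a $\Bbbk$-basis of $\operatorname{End}_{\mathcal{P}_r(n)}(\mathbf{V}^{\otimes r})$, so the scalars $c(\sigma)$, $c(w)$ exist and are unique. Matrix coordinates: in (i), $X_{\underline{i},\underline{j}}$ is the coefficient of $\mathbf{v}_{\underline{j}}$ in $X(\mathbf{v}_{\underline{i}})$, so that $\Phi(\sigma)_{\underline{i},\underline{j}}=\delta_{i_{\sigma(1)},j_1}\cdots\delta_{i_{\sigma(r)},j_r}$; in (ii), $X_{\underline{i},\underline{j}}$ is the coefficient of $\mathbf{v}_{\underline{i}}$ in $X(\mathbf{v}_{\underline{j}})$, so that $\Psi(w)_{\underline{i},\underline{j}}=\delta_{i_1,w(j_1)}\cdots\delta_{i_r,w(j_r)}$.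 *)

theory Defs
  imports
    Complex_Main
    "HOL-Library.FuncSet"
    "HOL-Library.Sublist"
    "HOL-Library.Disjoint_Sets"
    "HOL-Combinatorics.Permutations"
begin

section \<open>Permutations in one-line notation\<close>

definition one_line :: "nat \<Rightarrow> (nat \<Rightarrow> nat) \<Rightarrow> nat list" where
  "one_line m \<sigma> = map \<sigma> [1..<Suc m]"

definition LLIS :: "nat \<Rightarrow> (nat \<Rightarrow> nat) \<Rightarrow> nat" where
  "LLIS m \<sigma> = Max {length xs | xs. subseq xs (one_line m \<sigma>) \<and> sorted_wrt (<) xs}"

definition LLDS :: "nat \<Rightarrow> (nat \<Rightarrow> nat) \<Rightarrow> nat" where
  "LLDS m \<sigma> = Max {length xs | xs. subseq xs (one_line m \<sigma>) \<and> sorted_wrt (>) xs}"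

definition coxeter_length :: "nat \<Rightarrow> (nat \<Rightarrow> nat) \<Rightarrow> nat" where
  "coxeter_length m \<sigma> = card {(a, b). a \<in> {1..m} \<and> b \<in> {1..m} \<and> a < b \<and> \<sigma> a > \<sigma> b}"

definition setB :: "nat \<Rightarrow> nat \<Rightarrow> (nat \<Rightarrow> nat) set" where
  "setB n r = {\<sigma>. \<sigma> permutes {1..r} \<and> LLDS r \<sigma> \<le> n}"

definition setC :: "nat \<Rightarrow> nat \<Rightarrow> (nat \<Rightarrow> nat) set" where
  "setC n r = {w. w permutes {1..n} \<and> int (LLIS n w) \<ge> int n - int r}"

definition is_unique_arg_min :: "('a \<Rightarrow> 'b::ord) \<Rightarrow> ('a \<Rightarrow> bool) \<Rightarrow> 'a \<Rightarrow> bool" where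
  "is_unique_arg_min f P x \<longleftrightarrow> is_arg_min f P x \<and> (\<forall>y. is_arg_min f P y \<longrightarrow> y = x)"


section \<open>Tuples and tensor space\<close>

text \<open>An element of $[n]^r$ is a function on \<open>{1..r}\<close>, taking the value
  \<^term>\<open>undefined\<close> elsewhere.\<close>

definition tuples :: "nat \<Rightarrow> nat \<Rightarrow> (nat \<Rightarrow> nat) set" where
  "tuples n r = ({1..r} \<rightarrow>\<^sub>E {1..n})"

definition place_act :: "nat \<Rightarrow> (nat \<Rightarrow> nat) \<Rightarrow> (nat \<Rightarrow> nat) \<Rightarrow> (nat \<Rightarrow> nat)" where
  "place_act r j \<sigma> = (\<lambda>k\<in>{1..r}. j (\<sigma> k))"

definition value_act :: "nat \<Rightarrow> (nat \<Rightarrow> nat) \<Rightarrow> (nat \<Rightarrow> nat) \<Rightarrow> (nat \<Rightarrow> nat)" where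
  "value_act r w j = (\<lambda>k\<in>{1..r}. w (j k))"

text \<open>The $r$-th tensor power of the free module of rank $n$ is the free module on the basis
  $v_j$, $j \in [n]^r$; a vector is identified with its coefficient function.\<close>

definition tensor_space :: "nat \<Rightarrow> nat \<Rightarrow> ((nat \<Rightarrow> nat) \<Rightarrow> 'k::comm_ring_1) set" where
  "tensor_space n r = {x. \<forall>j. j \<notin> tuples n r \<longrightarrow> x j = 0}"

definition basis_vec :: "(nat \<Rightarrow> nat) \<Rightarrow> ((nat \<Rightarrow> nat) \<Rightarrow> 'k::comm_ring_1)" where
  "basis_vec j = (\<lambda>i. if i = j then 1 else 0)"

type_synonym 'k tensor_map = "((nat \<Rightarrow> nat) \<Rightarrow> 'k) \<Rightarrow> ((nat \<Rightarrow> nat) \<Rightarrow> 'k)"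

text \<open>Endomorphisms are \<^term>\<open>undefined\<close> outside the tensor space, so that equality of
  functions is equality of endomorphisms.\<close>

definition End_tensor :: "nat \<Rightarrow> nat \<Rightarrow> ('k::comm_ring_1) tensor_map set" where
  "End_tensor n r = {X \<in> tensor_space n r \<rightarrow>\<^sub>E tensor_space n r.
     (\<forall>x\<in>tensor_space n r. \<forall>y\<in>tensor_space n r. X (\<lambda>j. x j + y j) = (\<lambda>j. X x j + X y j)) \<and>
     (\<forall>a. \<forall>x\<in>tensor_space n r. X (\<lambda>j. a * x j) = (\<lambda>j. a * X x j))}"

text \<open>\<open>lin_ext n r f\<close> is the linear map with $v_j \mapsto f(j)$.\<close>

definition lin_ext ::
    "nat \<Rightarrow> nat \<Rightarrow> ((nat \<Rightarrow> nat) \<Rightarrow> ((nat \<Rightarrow> nat) \<Rightarrow> 'k)) \<Rightarrow> ('k::comm_ring_1) tensor_map" where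
  "lin_ext n r f = (\<lambda>x\<in>tensor_space n r. \<lambda>i. \<Sum>j\<in>tuples n r. x j * f j i)"

definition lin_comb ::
    "nat \<Rightarrow> nat \<Rightarrow> 'a set \<Rightarrow> ('a \<Rightarrow> 'k) \<Rightarrow> ('a \<Rightarrow> 'k tensor_map) \<Rightarrow> ('k::comm_ring_1) tensor_map" where
  "lin_comb n r A c F = (\<lambda>x\<in>tensor_space n r. \<lambda>i. \<Sum>s\<in>A. c s * F s x i)"

definition centralizer ::
    "nat \<Rightarrow> nat \<Rightarrow> 'k tensor_map set \<Rightarrow> ('k::comm_ring_1) tensor_map set" where
  "centralizer n r A = {X \<in> End_tensor n r.
     \<forall>Y\<in>A. compose (tensor_space n r) X Y = compose (tensor_space n r) Y X}"


section \<open>The actions on tensor space and their commutants\<close>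

definition \<Phi> :: "nat \<Rightarrow> nat \<Rightarrow> (nat \<Rightarrow> nat) \<Rightarrow> ('k::comm_ring_1) tensor_map" where
  "\<Phi> n r \<sigma> = lin_ext n r (\<lambda>j. basis_vec (place_act r j \<sigma>))"

definition \<Psi> :: "nat \<Rightarrow> nat \<Rightarrow> (nat \<Rightarrow> nat) \<Rightarrow> ('k::comm_ring_1) tensor_map" where
  "\<Psi> n r w = lin_ext n r (\<lambda>j. basis_vec (value_act r w j))"

definition Schur_algebra :: "nat \<Rightarrow> nat \<Rightarrow> ('k::comm_ring_1) tensor_map set" where
  "Schur_algebra n r = centralizer n r (\<Phi> n r ` {\<sigma>. \<sigma> permutes {1..r}})"

definition End_Schur :: "nat \<Rightarrow> nat \<Rightarrow> ('k::comm_ring_1) tensor_map set" where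
  "End_Schur n r = centralizer n r (Schur_algebra n r)"

text \<open>The vertices $1,\dots,r$ are \<open>Inl 1, \<dots>, Inl r\<close> and the vertices $1',\dots,r'$ are
  \<open>Inr 1, \<dots>, Inr r\<close>.\<close>

definition diagrams :: "nat \<Rightarrow> (nat + nat) set set set" where
  "diagrams r = {d. partition_on ({1..r} <+> {1..r}) d}"

definition diagram_entry ::
    "(nat + nat) set set \<Rightarrow> (nat \<Rightarrow> nat) \<Rightarrow> (nat \<Rightarrow> nat) \<Rightarrow> 'k::comm_ring_1" where
  "diagram_entry d i j =
     (if \<forall>b\<in>d. \<forall>u\<in>b. \<forall>v\<in>b. case_sum i j u = case_sum i j v then 1 else 0)"

text \<open>The entry at $(i,j)$ is taken to be the coefficient of $v_i$ in the image of $v_j$. With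
  the transposed convention, $d$ acts as its reflection (exchanging $a$ and $a'$) does here, so
  the set of operators is the same.\<close>

definition diagram_op :: "nat \<Rightarrow> nat \<Rightarrow> (nat + nat) set set \<Rightarrow> ('k::comm_ring_1) tensor_map" where
  "diagram_op n r d =
     lin_ext n r (\<lambda>j i. if i \<in> tuples n r then diagram_entry d i j else 0)"

definition End_partition :: "nat \<Rightarrow> nat \<Rightarrow> ('k::comm_ring_1) tensor_map set" where
  "End_partition n r = centralizer n r (diagram_op n r ` diagrams r)"

end

theory Submission
  imports Defs
begin

text \<open>Both parts are instances of one triangularity argument. Evaluating
  $X = \sum_\tau c(\tau)\,\Phi(\tau)$ at the matrix position $\varphi(\sigma)$ gives
  $X_{\varphi(\sigma)} = \sum_\tau c(\tau)$, where $\tau$ runs over the elements of $\mathcal{B}$ with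
  $\underline{i}(\sigma)\,\tau = \underline{j}(\sigma)$ (\<open>lin_comb_matrix_entry\<close>). So the coordinates
  of $X$ at the chosen positions arise from the scalars $c$ by a zero-one matrix over
  $\mathcal{B} \times \mathcal{B}$. Among the $\tau$ that occur in row $\sigma$, the element $\sigma$ itself is
  the only one of least Coxeter length; hence the matrix is unitriangular for every linear order
  that refines Coxeter length, and it has an inverse with integer entries
  (\<open>unitriangular_int_left_inverse\<close>). The entries of this inverse are the integers sought. They
  depend only on the combinatorial data, not on $X$ or on $\Bbbk$. The argument for
  $\mathcal{C}$ and $\Psi$ is the same.\<close>

text \<open>Row $s$ of $M$ is the unit vector at $s$ plus a combination of unit vectors at indices of larger
  rank. Solving this for the unit vector at $s$ writes it, by descending induction on the rank,
  as an integer combination of rows of $M$; the coefficients form row $s$ of the inverse.\<close>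

lemma unitriangular_int_left_inverse:
  fixes M :: "'a \<Rightarrow> 'a \<Rightarrow> int" and rank :: "'a \<Rightarrow> nat"
  assumes fin: "finite A"
    and diag: "\<And>s. s \<in> A \<Longrightarrow> M s s = 1"
    and upper: "\<And>s t. s \<in> A \<Longrightarrow> t \<in> A \<Longrightarrow> M s t \<noteq> 0 \<Longrightarrow> s \<noteq> t \<Longrightarrow> rank s < rank t"
  shows "\<exists>N :: 'a \<Rightarrow> 'a \<Rightarrow> int. \<forall>s\<in>A. \<forall>t\<in>A. (\<Sum>u\<in>A. N s u * M u t) = (if s = t then 1 else 0)"
proof -
  have row: "\<exists>a :: 'a \<Rightarrow> int. \<forall>t\<in>A. (\<Sum>u\<in>A. a u * M u t) = (if s = t then 1 else 0)"
    if "s \<in> A" for s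
    using that
  proof (induction "Max (rank ` A) - rank s" arbitrary: s rule: less_induct)
    case less
    let ?T = "{t \<in> A. rank s < rank t}"
    have "\<exists>a :: 'a \<Rightarrow> int. \<forall>v\<in>A. (\<Sum>u\<in>A. a u * M u v) = (if t = v then 1 else 0)"
      if t: "t \<in> ?T" for t
    proof (rule less.hyps)
      have "rank t \<le> Max (rank ` A)"
        using fin t by simp
      then show "Max (rank ` A) - rank t < Max (rank ` A) - rank s"
        using t by auto
    qed (use t in auto)
    then have "\<forall>t\<in>?T. \<exists>a :: 'a \<Rightarrow> int. \<forall>v\<in>A. (\<Sum>u\<in>A. a u * M u v) = (if t = v then 1 else 0)"
      by blast
    from bchoice [OF this] obtain e :: "'a \<Rightarrow> 'a \<Rightarrow> int" where e:
      "\<And>t v. t \<in> ?T \<Longrightarrow> v \<in> A \<Longrightarrow> (\<Sum>u\<in>A. e t u * M u v) = (if t = v then 1 else 0)"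
      by blast
    define a where "a = (\<lambda>u. (if u = s then 1 else 0) - (\<Sum>t\<in>?T. M s t * e t u))"
    have "(\<Sum>u\<in>A. a u * M u v) = (if s = v then 1 else 0)" if v: "v \<in> A" for v
    proof -
      have "(\<Sum>u\<in>A. a u * M u v) =
          (\<Sum>u\<in>A. (if u = s then M u v else 0)) - (\<Sum>u\<in>A. \<Sum>t\<in>?T. M s t * (e t u * M u v))"
        unfolding a_def sum_subtractf [symmetric]
        by (intro sum.cong) (auto simp: left_diff_distrib sum_distrib_right mult.assoc)
      also have "(\<Sum>u\<in>A. (if u = s then M u v else 0)) = M s v"
        using fin less.prems by simp
      also have "(\<Sum>u\<in>A. \<Sum>t\<in>?T. M s t * (e t u * M u v)) =
          (\<Sum>t\<in>?T. M s t * (\<Sum>u\<in>A. e t u * M u v))"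
        by (subst sum.swap) (simp add: sum_distrib_left)
      also have "\<dots> = (\<Sum>t\<in>?T. if t = v then M s t else 0)"
        by (intro sum.cong) (use e v in auto)
      also have "\<dots> = (if rank s < rank v then M s v else 0)"
        using fin v by simp
      finally show ?thesis
        using upper [of s v] diag [of s] less.prems v by auto
    qed
    then show ?case
      by blast
  qed
  have "\<forall>s\<in>A. \<exists>a :: 'a \<Rightarrow> int. \<forall>t\<in>A. (\<Sum>u\<in>A. a u * M u t) = (if s = t then 1 else 0)"
    using row by blast
  from bchoice [OF this] show ?thesis .
qed

text \<open>A unique minimizer of the rank on the feasible set of each $s$ is exactly what makes the
  incidence matrix of feasibility unitriangular: any other feasible element has strictly larger rank.
  So an unknown family is recovered integrally from its sums over the feasible sets.\<close>

lemma recover_from_sums_with_unique_minimizer: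
  fixes rank :: "'a \<Rightarrow> nat" and P :: "'a \<Rightarrow> 'a \<Rightarrow> bool"
  assumes fin: "finite A"
    and uniq_min: "\<And>s. s \<in> A \<Longrightarrow> is_unique_arg_min rank (\<lambda>t. t \<in> A \<and> P s t) s"
  shows "\<exists>N :: 'a \<Rightarrow> 'a \<Rightarrow> int. \<forall>c :: 'a \<Rightarrow> 'k::comm_ring_1. \<forall>s\<in>A.
    c s = (\<Sum>u\<in>A. of_int (N s u) * (\<Sum>t\<in>A. if P u t then c t else 0))"
proof -
  define M :: "'a \<Rightarrow> 'a \<Rightarrow> int" where "M = (\<lambda>s t. if P s t then 1 else 0)"
  have "M s s = 1" if "s \<in> A" for s
    using uniq_min [OF that] by (auto simp: M_def is_unique_arg_min_def is_arg_min_def)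
  moreover have "rank s < rank t" if "s \<in> A" "t \<in> A" "M s t \<noteq> 0" "s \<noteq> t" for s t
  proof (rule ccontr)
    assume "\<not> rank s < rank t"
    then have "is_arg_min rank (\<lambda>t. t \<in> A \<and> P s t) t"
      using uniq_min [OF \<open>s \<in> A\<close>] that
      by (force simp: M_def is_unique_arg_min_def is_arg_min_def split: if_splits)
    then show False
      using uniq_min [OF \<open>s \<in> A\<close>] \<open>s \<noteq> t\<close> by (auto simp: is_unique_arg_min_def)
  qed
  ultimately obtain N :: "'a \<Rightarrow> 'a \<Rightarrow> int" where
    N: "\<And>s t. s \<in> A \<Longrightarrow> t \<in> A \<Longrightarrow> (\<Sum>u\<in>A. N s u * M u t) = (if s = t then 1 else 0)"
    using unitriangular_int_left_inverse [OF fin, of M rank] by blast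
  have "c s = (\<Sum>u\<in>A. of_int (N s u) * (\<Sum>t\<in>A. if P u t then c t else 0))"
    if s: "s \<in> A" for c :: "'a \<Rightarrow> 'k" and s
  proof -
    have "(\<Sum>u\<in>A. of_int (N s u) * (\<Sum>t\<in>A. if P u t then c t else 0)) =
        (\<Sum>u\<in>A. \<Sum>t\<in>A. of_int (N s u * M u t) * c t)"
      by (auto simp: M_def sum_distrib_left intro!: sum.cong)
    also have "\<dots> = (\<Sum>t\<in>A. of_int (\<Sum>u\<in>A. N s u * M u t) * c t)"
      by (subst sum.swap) (simp add: sum_distrib_right)
    also have "\<dots> = (\<Sum>t\<in>A. if s = t then c t else 0)"
      by (intro sum.cong) (use N s in auto)
    finally show ?thesis
      using fin s by simp
  qed
  then show ?thesis
    by blast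
qed

lemma lin_comb_matrix_entry:
  assumes "i \<in> tuples n r"
  shows "lin_comb n r A c (\<lambda>s. lin_ext n r (\<lambda>j. basis_vec (g s j))) (basis_vec i) k =
    (\<Sum>s\<in>A. if g s i = k then c s else (0 :: 'k::comm_ring_1))"
proof -
  have fin: "finite (tuples n r)"
    unfolding tuples_def by (intro finite_PiE) auto
  have mem: "(basis_vec i :: _ \<Rightarrow> 'k) \<in> tensor_space n r"
    using assms by (auto simp: tensor_space_def basis_vec_def)
  have entry: "lin_ext n r (\<lambda>j. basis_vec (g s j)) (basis_vec i) k =
      (if g s i = k then 1 else (0 :: 'k))" for s
  proof -
    have "lin_ext n r (\<lambda>j. basis_vec (g s j)) (basis_vec i) k =
        (\<Sum>j\<in>tuples n r. basis_vec i j * basis_vec (g s j) k :: 'k)"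
      using mem by (simp add: lin_ext_def)
    also have "\<dots> = (\<Sum>j\<in>tuples n r. if j = i then basis_vec (g s i) k else 0)"
      by (rule sum.cong) (simp_all add: basis_vec_def)
    also have "\<dots> = basis_vec (g s i) k"
      using fin assms by simp
    finally show ?thesis
      by (simp add: basis_vec_def)
  qed
  have "lin_comb n r A c (\<lambda>s. lin_ext n r (\<lambda>j. basis_vec (g s j))) (basis_vec i) k =
      (\<Sum>s\<in>A. c s * lin_ext n r (\<lambda>j. basis_vec (g s j)) (basis_vec i) k)"
    using mem by (simp add: lin_comb_def)
  also have "\<dots> = (\<Sum>s\<in>A. if g s i = k then c s else 0)"
    by (rule sum.cong) (simp_all add: entry)
  finally show ?thesis .
qed

theorem corollary2p2:
  fixes n r :: nat
    and \<phi> \<psi> :: "(nat \<Rightarrow> nat) \<Rightarrow> (nat \<Rightarrow> nat) \<times> (nat \<Rightarrow> nat)"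
  assumes n: "n \<ge> 1"
    and \<phi>_maps: "\<phi> \<in> setB n r \<rightarrow> tuples n r \<times> tuples n r"
    and \<phi>_inj: "inj_on \<phi> (setB n r)"
    and \<phi>_min: "\<And>\<sigma>. \<sigma> \<in> setB n r \<Longrightarrow>
      is_unique_arg_min (coxeter_length r)
        (\<lambda>\<sigma>'. \<sigma>' \<in> setB n r \<and> place_act r (fst (\<phi> \<sigma>)) \<sigma>' = snd (\<phi> \<sigma>)) \<sigma>"
    and \<psi>_maps: "\<psi> \<in> setC n r \<rightarrow> tuples n r \<times> tuples n r"
    and \<psi>_inj: "inj_on \<psi> (setC n r)"
    and \<psi>_min: "\<And>w. w \<in> setC n r \<Longrightarrow>
      is_unique_arg_min (coxeter_length n)
        (\<lambda>w'. w' \<in> setC n r \<and> value_act r w' (snd (\<psi> w)) = fst (\<psi> w)) w"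
  shows "(\<exists>a :: (nat \<Rightarrow> nat) \<Rightarrow> (nat \<Rightarrow> nat) \<Rightarrow> int.
           \<forall>X \<in> (End_Schur n r :: ('k::comm_ring_1) tensor_map set). \<forall>c :: (nat \<Rightarrow> nat) \<Rightarrow> 'k.
             X = lin_comb n r (setB n r) c (\<Phi> n r) \<longrightarrow>
             (\<forall>\<sigma>\<in>setB n r. c \<sigma> =
               (\<Sum>\<sigma>'\<in>setB n r. of_int (a \<sigma> \<sigma>') * X (basis_vec (fst (\<phi> \<sigma>'))) (snd (\<phi> \<sigma>')))))
       \<and> (\<exists>b :: (nat \<Rightarrow> nat) \<Rightarrow> (nat \<Rightarrow> nat) \<Rightarrow> int.
           \<forall>X \<in> (End_partition n r :: 'k tensor_map set). \<forall>c :: (nat \<Rightarrow> nat) \<Rightarrow> 'k.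
             X = lin_comb n r (setC n r) c (\<Psi> n r) \<longrightarrow>
             (\<forall>w\<in>setC n r. c w =
               (\<Sum>w'\<in>setC n r. of_int (b w w') * X (basis_vec (snd (\<psi> w'))) (fst (\<psi> w')))))"
proof -
  have finB: "finite (setB n r)"
    unfolding setB_def by (rule finite_subset [OF _ finite_permutations [of "{1..r}"]]) auto
  have finC: "finite (setC n r)"
    unfolding setC_def by (rule finite_subset [OF _ finite_permutations [of "{1..n}"]]) auto
  have iB: "fst (\<phi> \<sigma>) \<in> tuples n r" if "\<sigma> \<in> setB n r" for \<sigma>
    using \<phi>_maps that by (auto simp: Pi_iff mem_Times_iff)
  have jC: "snd (\<psi> w) \<in> tuples n r" if "w \<in> setC n r" for w
    using \<psi>_maps that by (auto simp: Pi_iff mem_Times_iff)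
  obtain a :: "(nat \<Rightarrow> nat) \<Rightarrow> (nat \<Rightarrow> nat) \<Rightarrow> int" where
    a: "\<And>(c :: (nat \<Rightarrow> nat) \<Rightarrow> 'k) \<sigma>. \<sigma> \<in> setB n r \<Longrightarrow>
      c \<sigma> = (\<Sum>\<sigma>'\<in>setB n r. of_int (a \<sigma> \<sigma>') *
        (\<Sum>\<tau>\<in>setB n r. if place_act r (fst (\<phi> \<sigma>')) \<tau> = snd (\<phi> \<sigma>') then c \<tau> else 0))"
    using recover_from_sums_with_unique_minimizer [OF finB \<phi>_min, where 'k = 'k] by blast
  obtain b :: "(nat \<Rightarrow> nat) \<Rightarrow> (nat \<Rightarrow> nat) \<Rightarrow> int" where
    b: "\<And>(c :: (nat \<Rightarrow> nat) \<Rightarrow> 'k) w. w \<in> setC n r \<Longrightarrow>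
      c w = (\<Sum>w'\<in>setC n r. of_int (b w w') *
        (\<Sum>t\<in>setC n r. if value_act r t (snd (\<psi> w')) = fst (\<psi> w') then c t else 0))"
    using recover_from_sums_with_unique_minimizer [OF finC \<psi>_min, where 'k = 'k] by blast
  have *: "c \<sigma> = (\<Sum>\<sigma>'\<in>setB n r. of_int (a \<sigma> \<sigma>') *
      lin_comb n r (setB n r) c (\<Phi> n r) (basis_vec (fst (\<phi> \<sigma>'))) (snd (\<phi> \<sigma>')))"
    if "\<sigma> \<in> setB n r" for c :: "(nat \<Rightarrow> nat) \<Rightarrow> 'k" and \<sigma>
    unfolding \<Phi>_def
    by (rule trans [OF a [OF that, of c]]) (simp add: lin_comb_matrix_entry iB cong: sum.cong)
  have **: "c w = (\<Sum>w'\<in>setC n r. of_int (b w w') *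
      lin_comb n r (setC n r) c (\<Psi> n r) (basis_vec (snd (\<psi> w'))) (fst (\<psi> w')))"
    if "w \<in> setC n r" for c :: "(nat \<Rightarrow> nat) \<Rightarrow> 'k" and w
    unfolding \<Psi>_def
    by (rule trans [OF b [OF that, of c]]) (simp add: lin_comb_matrix_entry jC cong: sum.cong)
  show ?thesis
    by (intro conjI exI [of _ a] exI [of _ b]) (use * ** in simp_all)
qed

end
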